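(* Let $K$ be a differential field with derivation $\partial$, let $\mathcal{L}=\sum_{k=0}^{n}a_{n-k}\partial^{n-k}$ be a linear differential operator of order $n$ with $a_i\in K$ and $a_0\neq 0$, and let $\widetilde{\mathcal{L}}$ be its Reversing. Let $\mathcal{R}$ be another linear differential operator over $K$ with nonzero order-zero coefficient. Then: 1. $\widetilde{\widetilde{\mathcal{L}}}=\mathcal{L}$. 2. $C(\mathcal{L})=C(\widetilde{\mathcal{L}})$. 3. If $C(\mathcal{L})=C(\mathcal{R})$, then $\widetilde{\mathcal{L}+\mathcal{R}}=\widetilde{\mathcal{L}}+\widetilde{\mathcal{R}}$.
   Context: A linear differential operator over a differential field $K$ is an element of the ring $K[\partial]$ (where $\partial a=a\partial+\partial(a)$ for $a\in K$); only operators $\mathcal{L}=\sum_{k=0}^{n}a_{n-k}\partial^{n-k}$ with $a_i\in K$ and $a_0\neq0$ are considered. If $\mathcal{L}$ has order $n$ (so $a_n\ne 0$), then $C(\mathcal{L})=n+1$ is its number of coefficients, and its Reversing is $\widetilde{\mathcal{L}}=\sum_{k=0}^{n}b_{n-k}\partial^{n-k}$ with $b_{n-k}=a_k$ for $k=0,1,\dots,n$. If $\mathcal{L}$ and $\mathcal{R}$ both have order $n$, with coefficients $a_j$ and $b_j$, then $\mathcal{L}+\mathcal{R}$ is regarded as written $\sum_{k=0}^{n}(a_{n-k}+b_{n-k})\partial^{n-k}$ with the same $n$, and its Reversing is formed from this expression (reversal with respect to $n$), even if some of these coefficients vanish. *)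

theory Defs
  imports "HOL-Computational_Algebra.Polynomial"
begin

class differential_field = field +
  fixes der :: "'a \<Rightarrow> 'a"
  assumes der_add: "der (a + b) = der a + der b"
    and der_mult: "der (a * b) = der a * b + a * der b"
begin

lemma der_0 [simp]: "der 0 = 0"
  using der_add[of 0 0] by simp

lemma der_1 [simp]: "der 1 = 0"
  using der_mult[of 1 1] by simp

end

text \<open>
  The ring \<open>K[\<partial>]\<close>. As a left \<open>K\<close>-vector space it has the basis \<open>1, \<partial>, \<partial>\<^sup>2, \<dots>\<close>, so a
  differential operator is stored as the polynomial with the same (left) coefficients;
  only the multiplication differs from that of polynomials. The type copy keeps the two
  ring structures apart.
\<close>

typedef (overloaded) 'a diffop = "UNIV :: 'a::differential_field poly set"
  morphisms coeff_poly Diffop ..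

lemmas Diffop_inv [simp] = Diffop_inverse[OF UNIV_I]

text \<open>
  Left multiplication by \<open>\<partial>\<close>: the rule \<open>\<partial> b = b \<partial> + der b\<close> gives
  \<open>\<partial> (\<Sum>j. b\<^sub>j \<partial>\<^sup>j) = (\<Sum>j. b\<^sub>j \<partial>\<^sup>j\<^sup>+\<^sup>1) + (\<Sum>j. der b\<^sub>j \<partial>\<^sup>j)\<close>.
\<close>

definition D_mult :: "'a::differential_field poly \<Rightarrow> 'a poly" where
  "D_mult q = pCons 0 q + map_poly der q"

definition ore_mult :: "'a::differential_field poly \<Rightarrow> 'a poly \<Rightarrow> 'a poly" where
  "ore_mult p q = (\<Sum>i\<le>degree p. smult (coeff p i) ((D_mult ^^ i) q))"

lemma coeff_map_der [simp]: "coeff (map_poly der q) i = der (coeff q i)"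
  by (simp add: coeff_map_poly)

lemma D_mult_add: "D_mult (p + q) = D_mult p + D_mult q"
  by (rule poly_eqI) (simp add: D_mult_def der_add coeff_pCons split: nat.split)

lemma D_mult_0 [simp]: "D_mult 0 = 0"
  by (simp add: D_mult_def)

lemma D_mult_smult: "D_mult (smult a q) = smult a (D_mult q) + smult (der a) q"
  by (rule poly_eqI) (simp add: D_mult_def der_mult coeff_pCons algebra_simps split: nat.split)

lemma D_mult_pow_add: "(D_mult ^^ i) (p + q) = (D_mult ^^ i) p + (D_mult ^^ i) q"
  by (induction i) (simp_all add: D_mult_add)

lemma D_mult_pow_0 [simp]: "(D_mult ^^ i) 0 = 0"
  by (induction i) simp_all

lemma ore_mult_bound:
  assumes "degree p \<le> n"
  shows "ore_mult p q = (\<Sum>i\<le>n. smult (coeff p i) ((D_mult ^^ i) q))"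
  unfolding ore_mult_def using assms
  by (intro sum.mono_neutral_left) (auto simp: coeff_eq_0)

lemma ore_mult_add_left: "ore_mult (p + p') q = ore_mult p q + ore_mult p' q"
proof -
  let ?n = "max (degree p) (degree p')"
  have "degree (p + p') \<le> ?n" by (rule degree_add_le_max)
  then show ?thesis
    by (simp add: ore_mult_bound[of _ ?n] smult_add_left sum.distrib)
qed

lemma ore_mult_add_right: "ore_mult p (q + q') = ore_mult p q + ore_mult p q'"
  by (simp add: ore_mult_def D_mult_pow_add smult_add_right sum.distrib)

lemma ore_mult_0_left [simp]: "ore_mult 0 q = 0"
  by (simp add: ore_mult_def)

lemma ore_mult_0_right [simp]: "ore_mult p 0 = 0"
  by (simp add: ore_mult_def)

lemma ore_mult_1_left [simp]: "ore_mult 1 q = q"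
  by (simp add: ore_mult_def)

lemma ore_mult_smult: "ore_mult (smult a p) q = smult a (ore_mult p q)"
  by (rule poly_eqI)
     (simp add: ore_mult_bound[of "smult a p" "degree p"] ore_mult_def degree_smult_le
      coeff_sum sum_distrib_left mult.assoc)

lemma ore_mult_pCons: "ore_mult (pCons a p) q = smult a q + ore_mult p (D_mult q)"
proof -
  have "ore_mult (pCons a p) q
      = (\<Sum>i\<le>Suc (degree p). smult (coeff (pCons a p) i) ((D_mult ^^ i) q))"
    by (rule ore_mult_bound) (rule degree_pCons_le)
  also have "\<dots> = smult a q + (\<Sum>i\<le>degree p. smult (coeff p i) ((D_mult ^^ i) (D_mult q)))"
    by (subst sum.atMost_Suc_shift) (simp add: funpow_swap1)
  finally show ?thesis by (simp add: ore_mult_def)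
qed

lemma map_der_pCons: "map_poly der (pCons a p) = pCons (der a) (map_poly der p)"
  by (rule poly_eqI) (simp add: coeff_pCons split: nat.split)

lemma ore_mult_D_mult: "ore_mult (D_mult p) q = D_mult (ore_mult p q)"
proof -
  have "ore_mult p (D_mult q) + ore_mult (map_poly der p) q = D_mult (ore_mult p q)"
  proof (induction p arbitrary: q)
    case 0
    show ?case by simp
  next
    case (pCons a p)
    show ?case
      using pCons.IH[of "D_mult q"]
      by (simp add: ore_mult_pCons map_der_pCons D_mult_add D_mult_smult algebra_simps)
  qed
  then show ?thesis
    by (simp add: D_mult_def[of p] ore_mult_add_left ore_mult_pCons)
qed

lemma ore_mult_assoc: "ore_mult (ore_mult p q) r = ore_mult p (ore_mult q r)"
  by (induction p arbitrary: q)
     (simp_all add: ore_mult_pCons ore_mult_add_left ore_mult_smult ore_mult_D_mult)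

lemma D_mult_monom: "D_mult (monom 1 n) = monom 1 (Suc n)"
  by (rule poly_eqI) (auto simp: D_mult_def coeff_pCons split: nat.split)

lemma D_mult_pow_1: "(D_mult ^^ n) 1 = monom 1 n"
  by (induction n) (simp_all add: D_mult_monom flip: one_pCons monom_0)

lemma ore_mult_1_right [simp]: "ore_mult p 1 = p"
  by (simp add: ore_mult_def D_mult_pow_1 smult_monom poly_as_sum_of_monoms)

instantiation diffop :: (differential_field) ring_1
begin

definition "0 = Diffop 0"
definition "1 = Diffop 1"
definition "L + R = Diffop (coeff_poly L + coeff_poly R)"
definition "- L = Diffop (- coeff_poly L)"
definition "L - R = Diffop (coeff_poly L - coeff_poly R)"
definition "L * R = Diffop (ore_mult (coeff_poly L) (coeff_poly R))"

instance
proof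
  show "(0::'a diffop) \<noteq> 1"
    by (simp add: zero_diffop_def one_diffop_def Diffop_inject)
qed (simp_all add: coeff_poly_inject[symmetric] zero_diffop_def one_diffop_def plus_diffop_def
      uminus_diffop_def minus_diffop_def times_diffop_def ore_mult_assoc
      ore_mult_add_left ore_mult_add_right algebra_simps)

end

definition op_const :: "'a::differential_field \<Rightarrow> 'a diffop" where
  "op_const a = Diffop [:a:]"

definition op_D :: "'a::differential_field diffop" where
  "op_D = Diffop [:0, 1:]"

definition op_coeff :: "'a::differential_field diffop \<Rightarrow> nat \<Rightarrow> 'a" where
  "op_coeff L i = coeff (coeff_poly L) i"

definition op_order :: "'a::differential_field diffop \<Rightarrow> nat" where
  "op_order L = degree (coeff_poly L)"

lemma op_D_const: "op_D * op_const a = op_const a * op_D + op_const (der a)"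
  by (simp add: coeff_poly_inject[symmetric] op_D_def op_const_def times_diffop_def
      plus_diffop_def ore_mult_pCons D_mult_def map_der_pCons)

lemma op_D_power: "op_D ^ i = Diffop (monom 1 i)"
proof (induction i)
  case 0
  show ?case by (simp add: one_diffop_def)
next
  case (Suc i)
  then show ?case
    by (simp add: op_D_def times_diffop_def ore_mult_pCons D_mult_monom)
qed

lemma op_const_mult_power: "op_const a * op_D ^ i = Diffop (monom a i)"
  by (simp add: op_D_power op_const_def times_diffop_def ore_mult_pCons smult_monom)

lemma coeff_poly_sum: "coeff_poly (sum f A) = (\<Sum>i\<in>A. coeff_poly (f i))"
  by (induction A rule: infinite_finite_induct)
     (simp_all add: zero_diffop_def plus_diffop_def)

lemma diffop_expansion:
  "L = (\<Sum>k\<le>op_order L. op_const (op_coeff L k) * op_D ^ k)"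
  by (simp add: coeff_poly_inject[symmetric] op_const_mult_power coeff_poly_sum
      op_coeff_def op_order_def poly_as_sum_of_monoms)

lemma op_coeff_order: "L \<noteq> 0 \<Longrightarrow> op_coeff L (op_order L) \<noteq> 0"
  by (auto simp: op_coeff_def op_order_def zero_diffop_def coeff_poly_inject[symmetric])

definition num_coeffs :: "'a::differential_field diffop \<Rightarrow> nat" where
  "num_coeffs L = op_order L + 1"

text \<open>
  Reversal relative to a formal order \<open>n\<close>, which may exceed the actual order. This is needed
  for \<open>L + R\<close>, where \<open>L\<close> and \<open>R\<close> have order \<open>n\<close>: the sum is reversed with respect to \<open>n\<close>
  even when leading terms cancel.
\<close>

definition reversing_wrt :: "nat \<Rightarrow> 'a::differential_field diffop \<Rightarrow> 'a diffop" where
  "reversing_wrt n L = (\<Sum>k\<le>n. op_const (op_coeff L k) * op_D ^ (n - k))"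

definition reversing :: "'a::differential_field diffop \<Rightarrow> 'a diffop" where
  "reversing L = reversing_wrt (op_order L) L"

end

theory Submission imports Defs begin

text \<open>Reversing only permutes left coefficients, exchanging positions i and n - i
  (\<open>op_coeff_reversing_wrt\<close>). Relative to the actual order it is
  \<open>reflect_poly\<close> (\<open>coeff_poly_reversing\<close>), which preserves the degree and
  is an involution when the constant coefficient is nonzero. For a fixed n the permutation is the
  same for every operator, so reversal is additive (\<open>reversing_wrt_add\<close>).\<close>

lemma op_coeff_reversing_wrt:
  "op_coeff (reversing_wrt n L) i = (if i \<le> n then op_coeff L (n - i) else 0)"
proof -
  have "reversing_wrt n L = (\<Sum>k\<le>n. op_const (op_coeff L (n - k)) * op_D ^ k)"
    unfolding reversing_wrt_def
    by (rule sum.reindex_bij_witness[where i = "\<lambda>k. n - k" and j = "\<lambda>k. n - k"]) auto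
  then have "coeff_poly (reversing_wrt n L) = (\<Sum>k\<le>n. monom (op_coeff L (n - k)) k)"
    by (simp add: op_const_mult_power coeff_poly_sum)
  then show ?thesis
    by (simp add: op_coeff_def[of "reversing_wrt n L"] coeff_sum)
qed

lemma coeff_poly_reversing: "coeff_poly (reversing L) = reflect_poly (coeff_poly L)"
  using op_coeff_reversing_wrt[of "op_order L" L]
  by (intro poly_eqI) (simp add: reversing_def coeff_reflect_poly op_coeff_def op_order_def)

lemma diffop_eqI: "(\<And>i. op_coeff L i = op_coeff R i) \<Longrightarrow> L = R"
  by (auto simp: op_coeff_def coeff_poly_inject[symmetric] intro: poly_eqI)

lemma op_coeff_add [simp]: "op_coeff (L + R) i = op_coeff L i + op_coeff R i"
  by (simp add: op_coeff_def plus_diffop_def)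

text \<open>Keeping n fixed is essential: \<open>reversing\<close> alone can fail to be additive,
  since cancellation may lower the order of the sum.\<close>

lemma reversing_wrt_add: "reversing_wrt n (L + R) = reversing_wrt n L + reversing_wrt n R"
  by (rule diffop_eqI) (simp add: op_coeff_reversing_wrt)

theorem proposition3p2:
  fixes L R :: "'a::differential_field diffop" and n :: nat
  assumes "op_order L = n"
    and "op_coeff L 0 \<noteq> 0"
    and "op_coeff R 0 \<noteq> 0"
  shows "reversing (reversing L) = L
    \<and> num_coeffs L = num_coeffs (reversing L)
    \<and> (num_coeffs L = num_coeffs R \<longrightarrow>
         reversing_wrt n (L + R) = reversing L + reversing R)"
proof (intro conjI impI)
  \<comment> \<open>This coefficient becomes the leading one after reversal, so the order does not
    drop.\<close>
  have c0: "coeff (coeff_poly L) 0 \<noteq> 0"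
    using assms(2) by (simp add: op_coeff_def)
  then show "reversing (reversing L) = L"
    by (simp add: coeff_poly_inject[symmetric] coeff_poly_reversing)
  show "num_coeffs L = num_coeffs (reversing L)"
    using c0 by (simp add: num_coeffs_def op_order_def coeff_poly_reversing)
  assume "num_coeffs L = num_coeffs R"
  \<comment> \<open>Equal coefficient counts give \<open>R\<close> order n as well, so both summands
    are reversed with respect to n.\<close>
  then show "reversing_wrt n (L + R) = reversing L + reversing R"
    using assms(1) by (simp add: num_coeffs_def reversing_def reversing_wrt_add)
qed

end
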